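(* Let $n>1$, let $r\ge 1$ be an integer, and let $L\subset\mathbb{P}^n$ be a line. If $L\cap\Delta_{n-2}=\emptyset$, then $L^{\star r}\subset\mathbb{P}^n$ is a linear space of dimension $\min\{r,n\}$.
   Context: The base field is $\mathbb{C}$. $\Delta_i\subset\mathbb{P}^n$ is the set of points having at most $i+1$ non-zero homogeneous coordinates (equivalently, at least $n-i$ zero coordinates). For points $p=[a_0:\dots:a_n]$, $q=[b_0:\dots:b_n]$ of $\mathbb{P}^n$, the Hadamard product $p\star q=[a_0b_0:\dots:a_nb_n]$ is defined when some $a_ib_i\neq0$, and is not defined otherwise. For varieties $X,Y\subset\mathbb{P}^n$, $X\star Y$ is the Zariski closure of $\{p\star q: p\in X,\ q\in Y,\ p\star q \text{ is defined}\}$. Hadamard powers are $X^{\star 0}=\{[1:\dots:1]\}$ and $X^{\star r}=X\star X^{\star(r-1)}$. *)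

theory Defs
  imports "HOL-Analysis.Analysis" "HOL-Library.Poly_Mapping"
begin

text \<open>
  The index type \<open>'n\<close> labels the homogeneous coordinates, so \<open>'n proj\<close> is the complex
  projective space of dimension \<open>CARD('n) - 1\<close>.
\<close>

definition proj_rel :: "complex ^ 'n::finite \<Rightarrow> complex ^ 'n \<Rightarrow> bool" where
  "proj_rel u v \<longleftrightarrow> u \<noteq> 0 \<and> v \<noteq> 0 \<and> (\<exists>c. c \<noteq> 0 \<and> u = c *s v)"

lemma part_equivp_proj_rel: "part_equivp (proj_rel :: complex ^ 'n::finite \<Rightarrow> _)"
proof (rule part_equivpI)
  have "proj_rel (1 :: complex ^ 'n) 1"
    unfolding proj_rel_def by (auto intro!: exI[of _ 1])
  then show "\<exists>v :: complex ^ 'n. proj_rel v v" ..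
  show "symp (proj_rel :: complex ^ 'n \<Rightarrow> _)"
  proof (rule sympI)
    fix u v :: "complex ^ 'n"
    assume "proj_rel u v"
    then obtain c where "u \<noteq> 0" "v \<noteq> 0" "c \<noteq> 0" "u = c *s v"
      by (auto simp: proj_rel_def)
    moreover from this have "v = inverse c *s u" by simp
    ultimately show "proj_rel v u"
      unfolding proj_rel_def using nonzero_imp_inverse_nonzero by blast
  qed
  show "transp (proj_rel :: complex ^ 'n \<Rightarrow> _)"
  proof (rule transpI)
    fix u v w :: "complex ^ 'n"
    assume "proj_rel u v" "proj_rel v w"
    then obtain c d where "u \<noteq> 0" "w \<noteq> 0" "c \<noteq> 0" "d \<noteq> 0" "u = (c * d) *s w"
      by (auto simp: proj_rel_def)
    then show "proj_rel u w"
      unfolding proj_rel_def by (metis mult_eq_0_iff)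
  qed
qed

quotient_type (overloaded) 'n proj = "complex ^ 'n::finite" / partial: proj_rel
  by (rule part_equivp_proj_rel)

lift_definition nonzero_coords :: "'n::finite proj \<Rightarrow> 'n set" is "\<lambda>a. {i. a $ i \<noteq> 0}"
  by (auto simp: proj_rel_def)

definition Delta :: "nat \<Rightarrow> 'n::finite proj set" where
  "Delta i = {p. card (nonzero_coords p) \<le> i + 1}"

text \<open>
  Polynomials in variables indexed by \<open>'n\<close> are finitely supported maps from exponent vectors to
  coefficients.
\<close>

type_synonym 'n mpoly = "('n \<Rightarrow>\<^sub>0 nat) \<Rightarrow>\<^sub>0 complex"

definition mpoly_eval :: "'n::finite mpoly \<Rightarrow> complex ^ 'n \<Rightarrow> complex" where
  "mpoly_eval f a =
     (\<Sum>m\<in>Poly_Mapping.keys f. Poly_Mapping.lookup f m * (\<Prod>i\<in>UNIV. (a $ i) ^ Poly_Mapping.lookup m i))"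

definition homogeneous :: "nat \<Rightarrow> 'n::finite mpoly \<Rightarrow> bool" where
  "homogeneous d f \<longleftrightarrow> (\<forall>m\<in>Poly_Mapping.keys f. (\<Sum>i\<in>UNIV. Poly_Mapping.lookup m i) = d)"

definition zero_locus :: "'n::finite mpoly set \<Rightarrow> 'n proj set" where
  "zero_locus S = {abs_proj a | a. a \<noteq> 0 \<and> (\<forall>f\<in>S. mpoly_eval f a = 0)}"

definition zariski_closed :: "'n::finite proj set \<Rightarrow> bool" where
  "zariski_closed Z \<longleftrightarrow> (\<exists>S. (\<forall>f\<in>S. \<exists>d. homogeneous d f) \<and> Z = zero_locus S)"

definition zariski_closure :: "'n::finite proj set \<Rightarrow> 'n proj set" where
  "zariski_closure A = zariski_closed hull A"

text \<open>The Hadamard product of two points is a partial operation: \<open>None\<close> means undefined.\<close>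

lift_definition hadamard :: "'n::finite proj \<Rightarrow> 'n proj \<Rightarrow> 'n proj option"
  is "\<lambda>a b. if \<exists>i. a $ i * b $ i \<noteq> 0 then Some (\<chi> i. a $ i * b $ i) else None"
proof -
  fix a a' b b' :: "complex ^ 'n"
  assume "proj_rel a a'" "proj_rel b b'"
  then obtain c d where cd: "c \<noteq> 0" "d \<noteq> 0" "a = c *s a'" "b = d *s b'"
    by (auto simp: proj_rel_def)
  have eq: "(\<chi> i. a $ i * b $ i) = (c * d) *s (\<chi> i. a' $ i * b' $ i)"
    using cd by (simp add: vec_eq_iff)
  show "rel_option proj_rel
      (if \<exists>i. a $ i * b $ i \<noteq> 0 then Some (\<chi> i. a $ i * b $ i) else None)
      (if \<exists>i. a' $ i * b' $ i \<noteq> 0 then Some (\<chi> i. a' $ i * b' $ i) else None)"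
  proof (cases "\<exists>i. a' $ i * b' $ i \<noteq> 0")
    case True
    then have 1: "(\<chi> i. a' $ i * b' $ i) \<noteq> 0" by (auto simp: vec_eq_iff)
    have 2: "\<exists>i. a $ i * b $ i \<noteq> 0" using True cd by auto
    have "proj_rel (\<chi> i. a $ i * b $ i) (\<chi> i. a' $ i * b' $ i)"
      unfolding proj_rel_def eq using 1 cd
      by (auto simp: vector_mul_eq_0 intro!: exI[of _ "c * d"])
    then show ?thesis using True 2 by simp
  next
    case False
    then have "\<not> (\<exists>i. a $ i * b $ i \<noteq> 0)" using cd by auto
    then show ?thesis using False by simp
  qed
qed

definition hadamard_set :: "'n::finite proj set \<Rightarrow> 'n proj set \<Rightarrow> 'n proj set" where
  "hadamard_set X Y = zariski_closure {z. \<exists>p\<in>X. \<exists>q\<in>Y. hadamard p q = Some z}"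

primrec hadamard_power :: "'n::finite proj set \<Rightarrow> nat \<Rightarrow> 'n proj set" where
  "hadamard_power X 0 = {abs_proj (\<chi> i. 1)}"
| "hadamard_power X (Suc r) = hadamard_set X (hadamard_power X r)"

text \<open>\<open>d\<close> is the projective dimension; the underlying vector subspace has dimension \<open>d + 1\<close>.\<close>

definition linear_space :: "nat \<Rightarrow> 'n::finite proj set \<Rightarrow> bool" where
  "linear_space d X \<longleftrightarrow>
     (\<exists>V :: (complex ^ 'n) set. vec.subspace V \<and> vec.dim V = d + 1 \<and> X = abs_proj ` (V - {0}))"

end

theory Submission
  imports Defs "HOL-Computational_Algebra.Fundamental_Theorem_Algebra"
begin

text \<open>
  Write \<open>L = P(V)\<close>.  The hypothesis says that a nonzero vector of \<open>V\<close> has at most one zero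
  coordinate, so \<open>V\<close> has a basis \<open>u, v\<close> such that \<open>u\<close> has no zero coordinate and the ratios
  \<open>t\<^sub>i = v\<^sub>i / u\<^sub>i\<close> are pairwise distinct.  Then \<open>L\<^sup>r\<close> is the projectivization of the space of
  vectors \<open>(u\<^sub>i\<^sup>r p(t\<^sub>i))\<^sub>i\<close> with \<open>p\<close> a polynomial of degree at most \<open>r\<close>: by the fundamental theorem
  of algebra every such \<open>p\<close> splits off a linear factor, so the products alone already fill this
  space and taking the closure adds nothing.  Its dimension is found by counting roots.
\<close>

subsection \<open>Linear subspaces are Zariski closed\<close>

definition linear_form :: "complex ^ 'n::finite \<Rightarrow> 'n mpoly" where
  "linear_form c = (\<Sum>i\<in>UNIV. Poly_Mapping.single (Poly_Mapping.single i 1) (c $ i))"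

lemma lookup_linear_form:
  "Poly_Mapping.lookup (linear_form c) m =
     (\<Sum>i\<in>UNIV. if m = Poly_Mapping.single i 1 then c $ i else 0)"
  unfolding linear_form_def lookup_sum
  by (auto simp: lookup_single when_def intro!: sum.cong)

lemma single_one_eq_iff:
  "Poly_Mapping.single i (1::nat) = Poly_Mapping.single j 1 \<longleftrightarrow> i = j"
  by (metis lookup_single_eq lookup_single_not_eq zero_neq_one)

lemma keys_linear_form:
  "Poly_Mapping.keys (linear_form c) \<subseteq> range (\<lambda>i. Poly_Mapping.single i 1)"
proof
  fix m assume "m \<in> Poly_Mapping.keys (linear_form c)"
  moreover have "Poly_Mapping.lookup (linear_form c) m = 0"
    if "m \<notin> range (\<lambda>i. Poly_Mapping.single i 1)"
    using that by (auto simp: lookup_linear_form intro!: sum.neutral)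
  ultimately show "m \<in> range (\<lambda>i. Poly_Mapping.single i 1)"
    by (auto simp: in_keys_iff)
qed

lemma homogeneous_linear_form: "homogeneous 1 (linear_form c)"
  unfolding homogeneous_def
proof
  fix m assume "m \<in> Poly_Mapping.keys (linear_form c)"
  then obtain i where "m = Poly_Mapping.single i 1"
    using keys_linear_form by blast
  then show "(\<Sum>j\<in>UNIV. Poly_Mapping.lookup m j) = 1"
    by (simp add: lookup_single when_def)
qed

lemma mpoly_eval_linear_form: "mpoly_eval (linear_form c) a = (\<Sum>i\<in>UNIV. c $ i * a $ i)"
proof -
  have mon: "(\<Prod>j\<in>UNIV. (a $ j) ^ Poly_Mapping.lookup (Poly_Mapping.single i 1) j) = a $ i" for i
  proof -
    have "(\<Prod>j\<in>UNIV. (a $ j) ^ Poly_Mapping.lookup (Poly_Mapping.single i 1) j) =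
        (\<Prod>j\<in>UNIV. if i = j then a $ j else 1)"
      by (intro prod.cong) (auto simp: lookup_single when_def)
    then show ?thesis by simp
  qed
  have "mpoly_eval (linear_form c) a =
      (\<Sum>m\<in>range (\<lambda>i. Poly_Mapping.single i 1). Poly_Mapping.lookup (linear_form c) m *
         (\<Prod>i\<in>UNIV. (a $ i) ^ Poly_Mapping.lookup m i))"
    unfolding mpoly_eval_def
    by (rule sum.mono_neutral_left) (use keys_linear_form in \<open>auto simp: in_keys_iff\<close>)
  also have "\<dots> = (\<Sum>i\<in>UNIV. Poly_Mapping.lookup (linear_form c) (Poly_Mapping.single i 1) * a $ i)"
    by (subst sum.reindex) (auto simp: inj_on_def mon single_one_eq_iff simp del: One_nat_def)
  finally show ?thesis by (simp add: lookup_linear_form single_one_eq_iff del: One_nat_def)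
qed

text \<open>A basis of \<open>V\<close> together with \<open>x\<close> is independent, so some
  linear \<open>g\<close> kills \<open>V\<close> and fixes \<open>x\<close>. A row of its matrix at
  a coordinate where \<open>x\<close> is nonzero gives the functional.\<close>

lemma linear_functional_separates:
  fixes V :: "(complex ^ 'n::finite) set"
  assumes "vec.subspace V" and "x \<notin> V"
  obtains c :: "complex ^ 'n"
  where "\<And>y. y \<in> V \<Longrightarrow> (\<Sum>i\<in>UNIV. c $ i * y $ i) = 0" and "(\<Sum>i\<in>UNIV. c $ i * x $ i) \<noteq> 0"
proof -
  obtain B where B: "B \<subseteq> V" "vec.independent B" "V \<subseteq> vec.span B"
    using vec.basis_exists by metis
  have "vec.span B \<subseteq> V"
    using B assms(1) by (intro vec.span_minimal)
  then have x: "x \<notin> vec.span B"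
    using assms(2) by blast
  then have "vec.independent (insert x B)"
    using B(2) by (simp add: vec.independent_insertI)
  then obtain g :: "complex ^ 'n \<Rightarrow> complex ^ 'n"
    where g: "Vector_Spaces.linear (*s) (*s) g"
      and gB: "\<forall>y\<in>insert x B. g y = (if y = x then x else 0)"
    using vec.linear_independent_extend[of "insert x B" "\<lambda>y. if y = x then x else 0"] by auto
  have gx: "g x = x"
    using gB by simp
  have "g y = 0" if "y \<in> B" for y
    using gB that x vec.span_base by fastforce
  then have gV: "g y = 0" if "y \<in> V" for y
    using vec.linear_eq_0_on_span[OF g] B(3) that by blast
  have "x \<noteq> 0"
    using assms vec.subspace_0 by blast
  then obtain k where k: "x $ k \<noteq> 0"
    by (auto simp: vec_eq_iff)
  have eq: "(\<Sum>i\<in>UNIV. (matrix g $ k) $ i * y $ i) = g y $ k" for y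
    using matrix_works[OF g, of y, symmetric] by (simp add: matrix_vector_mult_def)
  show ?thesis
    by (rule that[of "matrix g $ k"]) (simp_all add: eq gV gx k)
qed

text \<open>The equations are all linear forms vanishing on \<open>V\<close>; by the separation
  lemma they have no common zero outside \<open>V\<close>.\<close>

lemma zariski_closed_subspace:
  fixes V :: "(complex ^ 'n::finite) set"
  assumes "vec.subspace V"
  shows "zariski_closed (abs_proj ` (V - {0}))"
proof -
  define S where "S = linear_form ` {c. \<forall>y\<in>V. (\<Sum>i\<in>UNIV. c $ i * y $ i) = 0}"
  have "(\<forall>f\<in>S. mpoly_eval f a = 0) \<longleftrightarrow> a \<in> V" for a
  proof
    assume vanish: "\<forall>f\<in>S. mpoly_eval f a = 0"
    show "a \<in> V"
    proof (rule ccontr)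
      assume "a \<notin> V"
      then obtain c where "\<And>y. y \<in> V \<Longrightarrow> (\<Sum>i\<in>UNIV. c $ i * y $ i) = 0"
        and "(\<Sum>i\<in>UNIV. c $ i * a $ i) \<noteq> 0"
        using linear_functional_separates[OF assms] by metis
      then show False
        using vanish by (simp add: S_def mpoly_eval_linear_form)
    qed
  next
    assume "a \<in> V"
    then show "\<forall>f\<in>S. mpoly_eval f a = 0"
      by (simp add: S_def mpoly_eval_linear_form)
  qed
  then have "abs_proj ` (V - {0}) = zero_locus S"
    unfolding zero_locus_def by auto
  moreover have "\<forall>f\<in>S. \<exists>d. homogeneous d f"
    unfolding S_def using homogeneous_linear_form by blast
  ultimately show ?thesis
    unfolding zariski_closed_def by blast
qed

lemma zariski_closure_subspace:
  "vec.subspace V \<Longrightarrow> zariski_closure (abs_proj ` (V - {0})) = abs_proj ` (V - {0})"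
  unfolding zariski_closure_def by (intro hull_same zariski_closed_subspace)

section \<open>Projective points through their representatives\<close>

lemma proj_rel_self: "a \<noteq> 0 \<Longrightarrow> proj_rel a a"
  unfolding proj_rel_def by (auto intro: exI[of _ 1])

lemma abs_proj_scale:
  assumes "a \<noteq> 0" and "c \<noteq> 0"
  shows "abs_proj (c *s a) = abs_proj a"
proof -
  have "proj_rel (c *s a) a"
    using assms by (auto simp: proj_rel_def)
  then show ?thesis
    using Quotient_rel_abs[OF Quotient_proj] by blast
qed

text \<open>On vectors \<open>*\<close> is componentwise, so definedness of the Hadamard product
  becomes \<open>a * b \<noteq> 0\<close>.\<close>

lemma hadamard_abs_proj:
  assumes "a \<noteq> 0" and "b \<noteq> 0"
  shows "hadamard (abs_proj a) (abs_proj b) =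
    (if a * b = 0 then None else Some (abs_proj (a * b)))"
proof -
  have mult: "(\<chi> i. a $ i * b $ i) = a * b"
    by (simp add: vec_eq_iff)
  have nonzero: "(\<exists>i. a $ i * b $ i \<noteq> 0) \<longleftrightarrow> a * b \<noteq> 0"
    by (simp add: vec_eq_iff)
  show ?thesis
    unfolding hadamard.abs_eq[OF assms[THEN proj_rel_self]] mult nonzero by simp
qed

lemma nonzero_coords_abs_proj: "a \<noteq> 0 \<Longrightarrow> nonzero_coords (abs_proj a) = {i. a $ i \<noteq> 0}"
  by (intro nonzero_coords.abs_eq proj_rel_self)

text \<open>Two distinct zero coordinates would leave at most \<open>CARD('n) - 2\<close> nonzero
  ones, which is the bound defining \<open>Delta (CARD('n) - 3)\<close>. The assumption
  \<open>CARD('n) \<ge> 3\<close> keeps the natural subtraction from truncating.\<close>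

lemma not_in_Delta_imp_one_zero_coord:
  fixes a :: "complex ^ 'n::finite"
  assumes "a \<noteq> 0" and "abs_proj a \<notin> Delta (CARD('n) - 3)" and "CARD('n) \<ge> 3"
    and "a $ i = 0" and "a $ j = 0"
  shows "i = j"
proof (rule ccontr)
  assume "i \<noteq> j"
  have "card {k. a $ k \<noteq> 0} \<le> card (UNIV - {i, j})"
    using assms by (intro card_mono) auto
  also have "\<dots> = CARD('n) - 2"
    using \<open>i \<noteq> j\<close> by (simp add: card_Diff_subset)
  finally show False
    using assms nonzero_coords_abs_proj[OF assms(1)] by (simp add: Delta_def)
qed

subsection \<open>Values of polynomials of bounded degree\<close>

text \<open>These are the values of binary forms of degree \<open>r\<close> at the points
  \<open>(u $ i, u $ i * t i)\<close>, written with the dehomogenized polynomial \<open>p\<close>.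
  The bound on the degree, rather than equality, makes the set a subspace.\<close>

definition poly_values :: "complex ^ 'n::finite \<Rightarrow> ('n \<Rightarrow> complex) \<Rightarrow> nat \<Rightarrow> (complex ^ 'n) set" where
  "poly_values u t r = {\<chi> i. u $ i ^ r * poly p (t i) | p. degree p \<le> r}"

lemma poly_valuesI: "degree p \<le> r \<Longrightarrow> (\<chi> i. u $ i ^ r * poly p (t i)) \<in> poly_values u t r"
  unfolding poly_values_def by blast

lemma poly_valuesE:
  assumes "x \<in> poly_values u t r"
  obtains p where "degree p \<le> r" and "x = (\<chi> i. u $ i ^ r * poly p (t i))"
  using assms unfolding poly_values_def by blast

lemma subspace_poly_values: "vec.subspace (poly_values u t r)"
proof (rule vec.subspaceI)
  show "0 \<in> poly_values u t r"
    using poly_valuesI[of 0 r u t] by (simp add: zero_vec_def)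
next
  fix x y assume "x \<in> poly_values u t r" "y \<in> poly_values u t r"
  then obtain p q where "degree p \<le> r" "x = (\<chi> i. u $ i ^ r * poly p (t i))"
    "degree q \<le> r" "y = (\<chi> i. u $ i ^ r * poly q (t i))"
    by (metis poly_valuesE)
  then show "x + y \<in> poly_values u t r"
    using poly_valuesI[of "p + q" r u t]
    by (simp add: degree_add_le plus_vec_def distrib_left)
next
  fix c x assume "x \<in> poly_values u t r"
  then obtain p where "degree p \<le> r" "x = (\<chi> i. u $ i ^ r * poly p (t i))"
    by (rule poly_valuesE)
  then show "c *s x \<in> poly_values u t r"
    using poly_valuesI[of "smult c p" r u t] degree_smult_le[of c p]
    by (simp add: vector_scalar_mult_def mult_ac)
qed

lemma poly_values_mult:
  assumes "x \<in> poly_values u t r" and "y \<in> poly_values u t s"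
  shows "x * y \<in> poly_values u t (r + s)"
proof -
  obtain p where p: "degree p \<le> r" "x = (\<chi> i. u $ i ^ r * poly p (t i))"
    using assms(1) by (rule poly_valuesE)
  obtain q where q: "degree q \<le> s" "y = (\<chi> i. u $ i ^ s * poly q (t i))"
    using assms(2) by (rule poly_valuesE)
  have "x * y = (\<chi> i. u $ i ^ (r + s) * poly (p * q) (t i))"
    by (simp add: p q vec_eq_iff power_add)
  moreover have "degree (p * q) \<le> r + s"
    using degree_mult_le[of p q] p q by linarith
  ultimately show ?thesis
    by (simp only: poly_valuesI)
qed

lemma complex_poly_split_linear:
  fixes p :: "complex poly"
  assumes "degree p \<le> Suc r"
  obtains l q where "degree l \<le> 1" and "degree q \<le> r" and "p = l * q"
proof (cases "degree p = 0")
  case True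
  then show ?thesis
    \<comment> \<open>A constant, possibly zero, is split as \<open>1 * p\<close>; only upper bounds
      on the degrees are required.\<close>
    using that[of 1 p] by simp
next
  case False
  then obtain z where "poly p z = 0"
    by (metis fundamental_theorem_of_algebra constant_degree)
  then obtain q where q: "p = [:- z, 1:] * q"
    by (metis poly_eq_0_iff_dvd dvdE)
  with False have "degree p = Suc (degree q)"
    by (subst q, subst degree_mult_eq) auto
  then show ?thesis
    using that[of "[:- z, 1:]" q] q assms by simp
qed

text \<open>A linear factor of the polynomial takes one factor \<open>u $ i\<close> of the weight,
  the cofactor takes the remaining \<open>r\<close>. This is the converse of
  \<open>poly_values_mult\<close>.\<close>

lemma poly_values_Suc_split:
  assumes "x \<in> poly_values u t (Suc r)"
  obtains a b where "a \<in> poly_values u t 1" and "b \<in> poly_values u t r" and "x = a * b"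
proof -
  obtain p where p: "degree p \<le> Suc r" "x = (\<chi> i. u $ i ^ Suc r * poly p (t i))"
    using assms by (rule poly_valuesE)
  then obtain l q where lq: "degree l \<le> 1" "degree q \<le> r" "p = l * q"
    using complex_poly_split_linear by metis
  then have "x = (\<chi> i. u $ i ^ 1 * poly l (t i)) * (\<chi> i. u $ i ^ r * poly q (t i))"
    by (simp add: p vec_eq_iff)
  then show ?thesis
    by (rule that[OF poly_valuesI[OF lq(1)] poly_valuesI[OF lq(2)]])
qed

text \<open>The weighted Vandermonde vectors \<open>w k\<close> with \<open>k \<le> r\<close> span,
  which bounds the dimension above. The first \<open>min (r + 1) CARD('n)\<close> of them are
  independent by counting roots.\<close>

lemma dim_poly_values:
  fixes u :: "complex ^ 'n::finite"
  assumes u: "\<And>i. u $ i \<noteq> 0" and t: "inj t"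
  shows "vec.dim (poly_values u t r) = min (r + 1) CARD('n)"
proof -
  define w where "w k = (\<chi> i. u $ i ^ r * t i ^ k)" for k
  have comb: "(\<Sum>k\<in>A. c k *s w k) = (\<chi> i. u $ i ^ r * poly (\<Sum>k\<in>A. monom (c k) k) (t i))"
    for A and c :: "nat \<Rightarrow> complex"
    by (simp add: vec_eq_iff w_def poly_sum poly_monom sum_distrib_left mult_ac)
  have "poly_values u t r \<subseteq> vec.span (w ` {..r})"
  proof
    fix x assume "x \<in> poly_values u t r"
    then obtain p where p: "degree p \<le> r" "x = (\<chi> i. u $ i ^ r * poly p (t i))"
      by (rule poly_valuesE)
    have "x = (\<Sum>k\<le>r. coeff p k *s w k)"
      using p by (simp add: comb poly_as_sum_of_monoms')
    moreover have "(\<Sum>k\<le>r. coeff p k *s w k) \<in> vec.span (w ` {..r})"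
      by (intro vec.span_sum vec.span_scale vec.span_base imageI)
    ultimately show "x \<in> vec.span (w ` {..r})"
      by simp
  qed
  then have "vec.dim (poly_values u t r) \<le> card (w ` {..r})"
    by (intro vec.dim_le_card) auto
  also have "\<dots> \<le> r + 1"
    using card_image_le[of "{..r}" w] by simp
  finally have upper: "vec.dim (poly_values u t r) \<le> min (r + 1) CARD('n)"
    using dim_subset_UNIV_cart_gen[of "poly_values u t r"] by simp
  define m where "m = min (r + 1) CARD('n)"
  \<comment> \<open>The weights are nonzero, so \<open>p\<close> vanishes at \<open>CARD('n)\<close>
    distinct points, more than its degree allows.\<close>
  have zero: "p = 0" if "\<And>i. u $ i ^ r * poly p (t i) = 0" "degree p < m" for p
  proof (rule poly_eqI_degree[where A = "range t"])
    show "poly p x = poly 0 x" if "x \<in> range t" for x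
      using \<open>\<And>i. u $ i ^ r * poly p (t i) = 0\<close> u that by auto
  qed (use that card_image[OF t] in \<open>auto simp: m_def\<close>)
  \<comment> \<open>Independence concerns the set of the \<open>w k\<close>; injectivity turns sums
    over this set into sums over exponents, and gives its cardinality.\<close>
  have inj: "inj_on w {..<m}"
  proof (rule inj_onI)
    fix k l assume kl: "k \<in> {..<m}" "l \<in> {..<m}" "w k = w l"
    then have "monom 1 k - monom 1 l = (0 :: complex poly)"
    proof (intro zero)
      show "u $ i ^ r * poly (monom 1 k - monom 1 l) (t i) = 0" for i
        using kl(3) by (simp add: w_def vec_eq_iff poly_monom right_diff_distrib)
      show "degree (monom 1 k - monom 1 l :: complex poly) < m"
        using kl by (intro degree_diff_less) (auto simp: degree_monom_eq)
    qed
    then show "k = l"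
      by (metis degree_monom_eq eq_iff_diff_eq_0 zero_neq_one)
  qed
  have "vec.independent (w ` {..<m})"
  proof (rule vec.independent_if_scalars_zero)
    fix f x assume sum0: "(\<Sum>x\<in>w ` {..<m}. f x *s x) = 0" and x: "x \<in> w ` {..<m}"
    define p where "p = (\<Sum>k<m. monom (f (w k)) k)"
    have "(\<Sum>k<m. f (w k) *s w k) = 0"
      using sum0 by (simp add: sum.reindex[OF inj])
    then have "u $ i ^ r * poly p (t i) = 0" for i
      by (simp add: comb p_def vec_eq_iff)
    moreover have "degree p < m"
    proof -
      have "degree p \<le> m - 1"
        unfolding p_def
        by (intro degree_sum_le) (auto intro: order.trans[OF degree_monom_le])
      moreover have "m > 0"
        by (simp add: m_def)
      ultimately show ?thesis
        by linarith
    qed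
    ultimately have "p = 0"
      by (rule zero)
    obtain k where k: "k < m" "x = w k"
      using x by blast
    then have "coeff p k = f x"
      by (simp add: p_def coeff_sum)
    then show "f x = 0"
      by (simp add: \<open>p = 0\<close>)
  qed simp
  moreover have "w ` {..<m} \<subseteq> poly_values u t r"
  proof
    fix x assume "x \<in> w ` {..<m}"
    then obtain k where "k < m" and x: "x = w k"
      by blast
    then have "k \<le> r"
      by (simp add: m_def)
    then show "x \<in> poly_values u t r"
      using poly_valuesI[of "monom 1 k" r u t] by (simp add: x w_def poly_monom degree_monom_eq)
  qed
  ultimately have "card (w ` {..<m}) \<le> vec.dim (poly_values u t r)"
    using vec.independent_card_le_dim by blast
  then have "min (r + 1) CARD('n) \<le> vec.dim (poly_values u t r)"
    unfolding card_image[OF inj] by (simp only: card_lessThan m_def)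
  with upper show ?thesis
    by (rule antisym)
qed

section \<open>Coordinates adapted to the line\<close>

text \<open>A generic \<open>u\<close> in \<open>V\<close> has no zero coordinate. With a second
  basis vector \<open>c\<close>, the ratios \<open>c $ i / u $ i\<close> are distinct, since a
  repeated ratio gives a nonzero vector of \<open>V\<close> with two zero coordinates.\<close>

lemma plane_eq_poly_values:
  fixes V :: "(complex ^ 'n::finite) set"
  assumes V: "vec.subspace V" "vec.dim V = 2" and card: "CARD('n) \<ge> 2"
    and zeros: "\<And>a i j. a \<in> V \<Longrightarrow> a \<noteq> 0 \<Longrightarrow> a $ i = 0 \<Longrightarrow> a $ j = 0 \<Longrightarrow> i = j"
  obtains u t where "\<And>i. u $ i \<noteq> 0" and "inj t" and "V = poly_values u t 1"
proof -
  obtain B where B: "B \<subseteq> V" "vec.independent B" "card B = 2"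
    using vec.basis_exists[of V] V(2) by metis
  then obtain b c where bc: "B = {b, c}" "b \<noteq> c"
    by (auto simp: card_2_iff)
  have bV: "b \<in> V" and cV: "c \<in> V"
    using B bc by auto
  have indep: "x = 0 \<and> y = 0" if "x *s b + y *s c = 0" for x y
  proof -
    have "(\<Sum>v\<in>B. (if v = b then x else y) *s v) = 0"
      using that bc by simp
    then have coeff0: "(if v = b then x else y) = 0" if "v \<in> B" for v
      using vec.independentD[OF B(2) _ subset_refl, of "\<lambda>v. if v = b then x else y" v] that bc
      by auto
    show ?thesis
      using coeff0[of b] coeff0[of c] bc by auto
  qed
  have nz: "b $ i \<noteq> 0 \<or> c $ i \<noteq> 0" for i
  proof (rule ccontr)
    assume i: "\<not> ?thesis"
    obtain j where j: "j \<noteq> i"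
      using card by (metis (full_types) card_2_iff' ex_card)
    \<comment> \<open>This combination cancels at \<open>j\<close>, and at \<open>i\<close> both
      \<open>b\<close> and \<open>c\<close> vanish. So it is zero, whence \<open>c $ j = 0\<close>
      and \<open>c\<close> itself has two zero coordinates.\<close>
    define a where "a = c $ j *s b + (- b $ j) *s c"
    have "a \<in> V"
      unfolding a_def using V bV cV by (intro vec.subspace_add vec.subspace_scale)
    moreover have "a $ i = 0" "a $ j = 0"
      using i by (simp_all add: a_def)
    ultimately have "a = 0"
      using zeros j by blast
    then have "c $ j = 0"
      using indep unfolding a_def by blast
    moreover have "c \<noteq> 0"
      using indep[of 0 1] by auto
    ultimately show False
      using zeros[OF cV] i j by blast
  qed
  \<comment> \<open>Each coordinate with \<open>c $ i \<noteq> 0\<close> excludes one value of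
    \<open>s\<close> for \<open>b + s *s c\<close>. If \<open>c $ i = 0\<close>, division by zero
    merely excludes the value 0, and the coordinate is \<open>b $ i \<noteq> 0\<close>.\<close>
  define bad where "bad = range (\<lambda>i. - b $ i / c $ i)"
  have "finite bad"
    by (simp add: bad_def)
  then obtain s where s: "s \<notin> bad"
    using ex_new_if_finite infinite_UNIV_char_0 by blast
  define u where "u = b + s *s c"
  define t where "t i = c $ i / u $ i" for i
  have uV: "u \<in> V"
    unfolding u_def using V bV cV by (intro vec.subspace_add vec.subspace_scale)
  have u: "u $ i \<noteq> 0" for i
  proof
    assume "u $ i = 0"
    then have 0: "b $ i + s * c $ i = 0"
      by (simp add: u_def)
    then have "c $ i \<noteq> 0"
      using nz[of i] by auto
    then have "s = - b $ i / c $ i"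
      using 0 by (simp add: field_simps add_eq_0_iff2)
    then show False
      using s by (auto simp: bad_def)
  qed
  have t: "inj t"
  proof (rule injI)
    fix i j assume eq: "t i = t j"
    define a where "a = c - t i *s u"
    have "a \<in> V"
      unfolding a_def using V uV cV by (intro vec.subspace_diff vec.subspace_scale)
    moreover have "a $ i = 0"
      using u[of i] by (simp add: a_def t_def)
    moreover have "a $ j = 0"
      using u[of j] unfolding a_def eq by (simp add: t_def)
    moreover have "a \<noteq> 0"
    proof
      assume "a = 0"
      \<comment> \<open>Independence would force both \<open>t i = 0\<close> and
        \<open>t i * s = 1\<close>.\<close>
      then have "(- t i) *s b + (1 - t i * s) *s c = 0"
        by (simp add: a_def u_def vec_eq_iff algebra_simps)
      then show False
        using indep by fastforce
    qed
    ultimately show "i = j"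
      using zeros by blast
  qed
  have "poly_values u t 1 \<subseteq> V"
  proof
    fix x assume "x \<in> poly_values u t 1"
    then obtain p where p: "degree p \<le> 1" "x = (\<chi> i. u $ i ^ 1 * poly p (t i))"
      by (rule poly_valuesE)
    then obtain \<alpha> \<beta> where "p = [:\<beta>, \<alpha>:]"
      by (metis le_SucE le_zero_eq One_nat_def degree_eq_zeroE degree1_coeffs pCons_0_0)
    then have "x = \<beta> *s u + \<alpha> *s c"
      using u by (simp add: p vec_eq_iff t_def field_simps)
    then show "x \<in> V"
      using V uV cV by (auto intro: vec.subspace_add vec.subspace_scale)
  qed
  \<comment> \<open>Both spaces have dimension 2, so the inclusion is an equality.\<close>
  moreover have "vec.dim (poly_values u t 1) = 2"
    using dim_poly_values[OF u t, of 1] card by simp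
  ultimately have "poly_values u t 1 = V"
    using V by (intro vec.subspace_dim_equal subspace_poly_values) auto
  then show ?thesis
    using that u t by blast
qed

subsection \<open>Hadamard powers of a line\<close>

text \<open>Multiplying values gives one inclusion, splitting off a linear factor the other. The set
  of products is thus already a projectivized subspace, hence closed.\<close>

lemma hadamard_set_poly_values:
  "hadamard_set (abs_proj ` (poly_values u t 1 - {0})) (abs_proj ` (poly_values u t r - {0})) =
     abs_proj ` (poly_values u t (Suc r) - {0})"
    (is "hadamard_set ?L ?X = ?Y")
proof -
  have "{z. \<exists>p\<in>?L. \<exists>q\<in>?X. hadamard p q = Some z} = ?Y"
  proof (intro subset_antisym subsetI)
    fix z assume "z \<in> {z. \<exists>p\<in>?L. \<exists>q\<in>?X. hadamard p q = Some z}"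
    then obtain a b where a: "a \<in> poly_values u t 1" "a \<noteq> 0"
      and b: "b \<in> poly_values u t r" "b \<noteq> 0"
      and z: "hadamard (abs_proj a) (abs_proj b) = Some z"
      by auto
    have "a * b \<noteq> 0" "z = abs_proj (a * b)"
      using z by (auto simp: hadamard_abs_proj a b split: if_splits)
    then show "z \<in> ?Y"
      using poly_values_mult[OF a(1) b(1)] by auto
  next
    fix z assume "z \<in> ?Y"
    then obtain x where x: "x \<in> poly_values u t (Suc r)" "x \<noteq> 0" "z = abs_proj x"
      by auto
    obtain a b where ab: "a \<in> poly_values u t 1" "b \<in> poly_values u t r" "x = a * b"
      using x(1) by (rule poly_values_Suc_split)
    then have "a \<noteq> 0" "b \<noteq> 0"
      using x(2) by auto
    then have "hadamard (abs_proj a) (abs_proj b) = Some z"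
      using x ab by (simp add: hadamard_abs_proj)
    then show "z \<in> {z. \<exists>p\<in>?L. \<exists>q\<in>?X. hadamard p q = Some z}"
      using ab \<open>a \<noteq> 0\<close> \<open>b \<noteq> 0\<close> by blast
  qed
  then show ?thesis
    by (simp add: hadamard_set_def zariski_closure_subspace subspace_poly_values)
qed

text \<open>Only constants remain and the weight is 1, so this is the line whose projectivization is
  the zeroth Hadamard power \<open>[1:...:1]\<close>.\<close>

lemma poly_values_0: "poly_values u t 0 = range (\<lambda>c. c *s 1)"
proof (intro subset_antisym subsetI)
  fix x assume "x \<in> poly_values u t 0"
  then obtain p where p: "degree p \<le> 0" "x = (\<chi> i. u $ i ^ 0 * poly p (t i))"
    by (rule poly_valuesE)
  then obtain c where "p = [:c:]"
    by (meson degree_eq_zeroE le_zero_eq)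
  then have "x = c *s 1"
    by (simp add: p vec_eq_iff)
  then show "x \<in> range (\<lambda>c. c *s 1)"
    by blast
next
  fix x :: "complex ^ 'a" assume "x \<in> range (\<lambda>c. c *s 1)"
  then obtain c where "x = c *s 1"
    by blast
  then show "x \<in> poly_values u t 0"
    using poly_valuesI[of "[:c:]" 0 u t] by (simp add: vector_scalar_mult_def)
qed

lemma hadamard_power_poly_values:
  "hadamard_power (abs_proj ` (poly_values u t 1 - {0})) r = abs_proj ` (poly_values u t r - {0})"
proof (induction r)
  case 0
  have one: "(\<chi> i. 1) = (1 :: complex ^ 'a)"
    by (simp add: vec_eq_iff)
  have "abs_proj ` (range (\<lambda>c. c *s (1 :: complex ^ 'a)) - {0}) = {abs_proj 1}"
  proof (intro subset_antisym subsetI)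
    fix z assume "z \<in> abs_proj ` (range (\<lambda>c. c *s (1 :: complex ^ 'a)) - {0})"
    then obtain c where c: "z = abs_proj (c *s (1 :: complex ^ 'a))" "c *s (1 :: complex ^ 'a) \<noteq> 0"
      by blast
    then have "c \<noteq> 0"
      by auto
    then show "z \<in> {abs_proj 1}"
      by (simp add: c abs_proj_scale)
  next
    fix z assume "z \<in> {abs_proj (1 :: complex ^ 'a)}"
    then show "z \<in> abs_proj ` (range (\<lambda>c. c *s (1 :: complex ^ 'a)) - {0})"
      by (intro image_eqI[of _ _ 1]) (auto intro: range_eqI[of _ _ 1])
  qed
  then show ?case
    by (simp add: poly_values_0 one)
next
  case (Suc r)
  then show ?case
    by (simp only: hadamard_power.simps hadamard_set_poly_values)
qed

theorem theorem3p4: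
  fixes L :: "'n::finite proj set" and n r :: nat
  assumes "CARD('n) = n + 1" and "n > 1" and "r \<ge> 1"
    and "linear_space 1 L"
    and "L \<inter> Delta (n - 2) = {}"
  shows "linear_space (min r n) (hadamard_power L r)"
proof -
  obtain V :: "(complex ^ 'n) set"
    where V: "vec.subspace V" "vec.dim V = 2" and L: "L = abs_proj ` (V - {0})"
    using assms(4) by (auto simp: linear_space_def)
  \<comment> \<open>Here \<open>n - 2\<close> is \<open>CARD('n) - 3\<close>, so avoiding
    \<open>Delta (n - 2)\<close> allows a nonzero vector of \<open>V\<close> at most one zero
    coordinate.\<close>
  have "i = j" if "a \<in> V" "a \<noteq> 0" "a $ i = 0" "a $ j = 0" for a :: "complex ^ 'n" and i j
  proof (rule not_in_Delta_imp_one_zero_coord)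
    show "abs_proj a \<notin> Delta (CARD('n) - 3)"
      using assms L that by auto
  qed (use assms that in auto)
  moreover have "CARD('n) \<ge> 2"
    using assms by simp
  ultimately obtain u t where u: "\<And>i. u $ i \<noteq> 0" and t: "inj t" and eq: "V = poly_values u t 1"
    using plane_eq_poly_values[OF V] by metis
  \<comment> \<open>With \<open>CARD('n) = n + 1\<close>, the vector dimension
    \<open>min (r + 1) (n + 1)\<close> is one more than the projective dimension
    \<open>min r n\<close>.\<close>
  have "vec.dim (poly_values u t r) = min r n + 1"
    using dim_poly_values[OF u t, of r] assms by simp
  then show ?thesis
    unfolding L eq hadamard_power_poly_values linear_space_def
    using subspace_poly_values by blast
qed

end
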